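(* Let $\mathbb{P}$ be a finite projective plane of odd order $p$, and consider the switching game on $\mathbb{P}$. Then any configuration with an even number of lit bulbs can be transformed by switch flips into a configuration with $0$ lit bulbs, and any configuration with an odd number of lit bulbs can be transformed by switch flips into a configuration with exactly $1$ lit bulb. In particular, the maximum number of lit bulbs in an irreducible configuration (the worst case) is $1$.
   Context: A finite projective plane of order $p$ has $p^2+p+1$ points and $p^2+p+1$ lines, each line contains $p+1$ points, each point lies on $p+1$ lines, and any two points lie on exactly one line. The switching game: there is one light bulb at each point, each either on (lit) or off; there is one switch for each line, and flipping the switch of a line toggles the state of every bulb at a point of that line. A configuration is an assignment of on/off states to all bulbs. A configuration is reducible if some finite sequence of switch flips produces a configuration with strictly fewer lit bulbs than the initial one; otherwise it is irreducible. *)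

theory Defs
  imports Main
begin

text \<open>
  Lines are identified with their point sets. Finiteness of the plane follows from
  the two cardinality axioms, since infinite sets have cardinality 0.
\<close>

locale finite_projective_plane =
  fixes points :: "'a set" and lines :: "'a set set" and p :: nat
  assumes line_subset: "l \<in> lines \<Longrightarrow> l \<subseteq> points"
    and card_points: "card points = p ^ 2 + p + 1"
    and card_lines: "card lines = p ^ 2 + p + 1"
    and card_line: "l \<in> lines \<Longrightarrow> card l = p + 1"
    and card_lines_through: "x \<in> points \<Longrightarrow> card {l \<in> lines. x \<in> l} = p + 1"
    and unique_line: "x \<in> points \<Longrightarrow> y \<in> points \<Longrightarrow> x \<noteq> y \<Longrightarrow> \<exists>!l. l \<in> lines \<and> x \<in> l \<and> y \<in> l"

text \<open>
  A configuration maps each point to True (lit) or False (off). Its values outside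
  the point set are irrelevant: they are neither counted nor toggled.
\<close>

type_synonym 'a config = "'a \<Rightarrow> bool"

definition num_lit :: "'a set \<Rightarrow> 'a config \<Rightarrow> nat" where
  "num_lit P c = card {x \<in> P. c x}"

definition flip :: "'a set \<Rightarrow> 'a config \<Rightarrow> 'a config" where
  "flip l c = (\<lambda>x. if x \<in> l then \<not> c x else c x)"

definition transformable :: "'a set set \<Rightarrow> 'a config \<Rightarrow> 'a config \<Rightarrow> bool" where
  "transformable L c d \<longleftrightarrow> (\<exists>ls. set ls \<subseteq> L \<and> d = fold flip ls c)"

definition reducible :: "'a set \<Rightarrow> 'a set set \<Rightarrow> 'a config \<Rightarrow> bool" where
  "reducible P L c \<longleftrightarrow> (\<exists>d. transformable L c d \<and> num_lit P d < num_lit P c)"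

abbreviation irreducible_config :: "'a set \<Rightarrow> 'a set set \<Rightarrow> 'a config \<Rightarrow> bool" where
  "irreducible_config P L c \<equiv> \<not> reducible P L c"

definition worst_case :: "'a set \<Rightarrow> 'a set set \<Rightarrow> nat" where
  "worst_case P L = Max {num_lit P c | c. irreducible_config P L c}"

text \<open>The maximum in \<open>worst_case\<close> is taken over a finite nonempty set.\<close>

lemma worst_case_set_finite_nonempty:
  assumes "finite P"
  shows "finite {num_lit P c | c. irreducible_config P L c}"
    and "{num_lit P c | c. irreducible_config P L c} \<noteq> {}"
proof -
  have "num_lit P c \<le> card P" for c
    unfolding num_lit_def by (rule card_mono) (use assms in auto)
  then have "{num_lit P c | c. irreducible_config P L c} \<subseteq> {..card P}" by auto
  then show "finite {num_lit P c | c. irreducible_config P L c}"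
    using finite_subset by blast
  have "irreducible_config P L (\<lambda>_. False)"
    by (simp add: reducible_def num_lit_def)
  then show "{num_lit P c | c. irreducible_config P L c} \<noteq> {}" by blast
qed

end

theory Submission
  imports Defs
begin

text \<open>
  Flip all \<open>p + 1\<close> lines through a point \<open>x\<close>: every other point lies on exactly one of them
  and is toggled, while \<open>x\<close> is toggled an even number of times. Doing this for \<open>x\<close> and for \<open>y\<close>
  toggles precisely \<open>x\<close> and \<open>y\<close>, so lit bulbs can be switched off in pairs. Conversely
  every line has \<open>p + 1\<close> points, an even number, so the parity of the number of lit bulbs
  never changes.
\<close>

lemma transformable_refl: "transformable L c c"
  unfolding transformable_def by (intro exI[of _ "[]"]) simp

lemma transformable_trans:
  assumes "transformable L c d" and "transformable L d e"
  shows "transformable L c e"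
proof -
  obtain ks ls where "set ks \<subseteq> L" "d = fold flip ks c" "set ls \<subseteq> L" "e = fold flip ls d"
    using assms unfolding transformable_def by blast
  then have "set (ks @ ls) \<subseteq> L \<and> e = fold flip (ks @ ls) c" by simp
  then show ?thesis unfolding transformable_def by blast
qed

text \<open>Toggling is addition modulo 2, so neither the order of the flips nor repetitions in
  pairs matter.\<close>

lemma fold_flip_apply:
  "fold flip ls c x \<longleftrightarrow> c x \<noteq> odd (length (filter (\<lambda>l. x \<in> l) ls))"
  by (induction ls arbitrary: c) (auto simp: flip_def)

text \<open>Passes from lists of flips to sets of lines: a repetition-free enumeration of
  \<open>K\<close> uses each switch once, so incidences can be counted by
  \<open>card\<close>.\<close>

lemma transformable_flip_set:
  assumes "finite K" and "K \<subseteq> L"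
  shows "transformable L c (\<lambda>x. c x \<noteq> odd (card {l \<in> K. x \<in> l}))"
proof -
  obtain ls where ls: "set ls = K" "distinct ls"
    using finite_distinct_list[OF \<open>finite K\<close>] by blast
  have "length (filter (\<lambda>l. x \<in> l) ls) = card {l \<in> K. x \<in> l}" for x
    using ls distinct_card[of "filter (\<lambda>l. x \<in> l) ls"] by simp
  then have "(\<lambda>x. c x \<noteq> odd (card {l \<in> K. x \<in> l})) = fold flip ls c"
    by (simp add: fun_eq_iff fold_flip_apply)
  then show ?thesis
    unfolding transformable_def using ls \<open>K \<subseteq> L\<close> by blast
qed

text \<open>The new lit set is the symmetric difference of \<open>?S\<close> and \<open>l\<close>,
  of size \<open>card ?S + card l - 2 * card (?S \<inter> l)\<close>.\<close>

lemma even_num_lit_flip: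
  assumes "finite P" and "l \<subseteq> P" and "even (card l)"
  shows "even (num_lit P (flip l c)) \<longleftrightarrow> even (num_lit P c)"
proof -
  let ?S = "{x \<in> P. c x}"
  have fin: "finite ?S" "finite l"
    using assms finite_subset by auto
  have "{x \<in> P. flip l c x} = (?S - l) \<union> (l - ?S)"
    using \<open>l \<subseteq> P\<close> by (auto simp: flip_def)
  then have "num_lit P (flip l c) = card (?S - l) + card (l - ?S)"
    unfolding num_lit_def using fin by (subst card_Un_disjoint[symmetric]) auto
  moreover have "card ?S = card (?S \<inter> l) + card (?S - l)"
    and "card l = card (?S \<inter> l) + card (l - ?S)"
    using card_Int_Diff[OF fin(1), of l] card_Int_Diff[OF fin(2), of ?S]
    by (simp_all add: Int_commute)
  ultimately show ?thesis
    using \<open>even (card l)\<close> unfolding num_lit_def by presburger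
qed

lemma even_num_lit_transformable:
  assumes "finite P" and "\<And>l. l \<in> L \<Longrightarrow> l \<subseteq> P \<and> even (card l)" and "transformable L c d"
  shows "even (num_lit P d) \<longleftrightarrow> even (num_lit P c)"
proof -
  have "set ls \<subseteq> L \<Longrightarrow> even (num_lit P (fold flip ls c)) \<longleftrightarrow> even (num_lit P c)" for ls
    by (induction ls arbitrary: c) (simp_all add: assms(1,2) even_num_lit_flip)
  then show ?thesis
    using assms(3) unfolding transformable_def by blast
qed

context finite_projective_plane
begin

lemma finite_points: "finite points"
  using card_points card.infinite by fastforce

lemma finite_lines: "finite lines"
  using card_lines card.infinite by fastforce

lemma transformable_flip_all_but:
  assumes "odd p" and "x \<in> points"
  shows "transformable lines c (flip (points - {x}) c)"
proof -
  let ?K = "{l \<in> lines. x \<in> l}"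
  have "odd (card {l \<in> ?K. z \<in> l}) \<longleftrightarrow> z \<in> points - {x}" for z
  proof -
    consider "z \<notin> points" | "z = x" | "z \<in> points" "z \<noteq> x" by blast
    then show ?thesis
    proof cases
      \<comment> \<open>Values off the plane count too, because the goal is an equality of total
        functions.\<close>
      case 1
      then have "{l \<in> ?K. z \<in> l} = {}" using line_subset by blast
      with 1 show ?thesis by (metis DiffD1 card.empty even_zero)
    next
      \<comment> \<open>All \<open>p + 1\<close> lines of \<open>?K\<close> contain
        \<open>x\<close>, an even number because \<open>p\<close> is odd.\<close>
      case 2
      then show ?thesis using card_lines_through[OF \<open>x \<in> points\<close>] \<open>odd p\<close> by simp
    next
      case 3
      then obtain l where "{l \<in> ?K. z \<in> l} = {l}"
        using unique_line[OF \<open>x \<in> points\<close>, of z] by blast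
      with 3 show ?thesis by simp
    qed
  qed
  then have "(\<lambda>z. c z \<noteq> odd (card {l \<in> ?K. z \<in> l})) = flip (points - {x}) c"
    by (auto simp: fun_eq_iff flip_def)
  then show ?thesis
    using transformable_flip_set[of ?K lines c] finite_lines by simp
qed

lemma transformable_flip_pair:
  assumes "odd p" and "x \<in> points" and "y \<in> points" and "x \<noteq> y"
  shows "transformable lines c (flip {x, y} c)"
proof -
  \<comment> \<open>Points other than \<open>x\<close> and \<open>y\<close> are toggled twice,
    \<open>x\<close> and \<open>y\<close> once each.\<close>
  have "flip {x, y} c = flip (points - {y}) (flip (points - {x}) c)"
    using assms by (auto simp: flip_def fun_eq_iff)
  then show ?thesis
    using transformable_flip_all_but assms transformable_trans by metis
qed

text \<open>Two lit bulbs are switched off together. The drop by exactly 2 keeps the residue modulo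
  2 in the induction that follows; that it is a drop gives the upper bound on the worst
  case.\<close>

lemma transformable_decrease:
  assumes "odd p" and "2 \<le> num_lit points c"
  obtains d where "transformable lines c d" and "num_lit points c = num_lit points d + 2"
proof -
  let ?S = "{x \<in> points. c x}"
  obtain T where T: "T \<subseteq> ?S" "card T = 2"
    using obtain_subset_with_card_n[of 2 ?S] assms(2) unfolding num_lit_def by metis
  then obtain x y where xy: "T = {x, y}" "x \<noteq> y" by (auto simp: card_2_iff)
  have "{z \<in> points. flip T c z} = ?S - T"
    using T by (auto simp: flip_def)
  then have "num_lit points (flip T c) = num_lit points c - 2"
    unfolding num_lit_def using T finite_points
    by (metis (no_types, lifting) card_Diff_subset finite_subset mem_Collect_eq subsetI)
  moreover have "transformable lines c (flip T c)"
    using transformable_flip_pair[OF \<open>odd p\<close>] T xy by auto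
  \<comment> \<open>Subtraction on naturals truncates; the bound
    \<open>2 \<le> num_lit points c\<close> makes it exact.\<close>
  ultimately show thesis using that assms(2) by simp
qed

lemma transformable_mod_2:
  assumes "odd p"
  shows "\<exists>d. transformable lines c d \<and> num_lit points d = num_lit points c mod 2"
proof (induction "num_lit points c" arbitrary: c rule: less_induct)
  case less
  show ?case
  proof (cases "num_lit points c < 2")
    case True
    then show ?thesis using transformable_refl by (metis mod_less)
  next
    case False
    then obtain d where d: "transformable lines c d" "num_lit points c = num_lit points d + 2"
      using transformable_decrease[OF assms, of c] by (metis not_less)
    then obtain e where "transformable lines d e" "num_lit points e = num_lit points d mod 2"
      using less[of d] by auto
    with d show ?thesis using transformable_trans by (metis mod_add_self2)
  qed
qed

lemma worst_case_eq_1: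
  assumes "odd p"
  shows "worst_case points lines = 1"
  unfolding worst_case_def
proof (rule Max_eqI)
  show "finite {num_lit points c | c. irreducible_config points lines c}"
    using worst_case_set_finite_nonempty(1)[OF finite_points] .
next
  fix n assume "n \<in> {num_lit points c | c. irreducible_config points lines c}"
  then obtain c where c: "n = num_lit points c" "irreducible_config points lines c" by blast
  show "n \<le> 1"
  proof (rule ccontr)
    assume "\<not> n \<le> 1"
    then obtain d where "transformable lines c d" "num_lit points c = num_lit points d + 2"
      using transformable_decrease[OF assms, of c] c by auto
    then show False using c(2) unfolding reducible_def by auto
  qed
next
  \<comment> \<open>The value 1 is attained by a single lit bulb; a point exists since
    \<open>p ^ 2 + p + 1\<close> is positive.\<close>
  obtain x where "x \<in> points"
    using card_points by fastforce
  let ?c = "\<lambda>z. z = x"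
  have "{z \<in> points. z = x} = {x}" using \<open>x \<in> points\<close> by blast
  then have one: "num_lit points ?c = 1" unfolding num_lit_def by simp
  \<comment> \<open>Lines have even size \<open>p + 1\<close>, so parity is invariant and 0 lit
    bulbs, the only smaller count, is out of reach.\<close>
  have "odd (num_lit points d)" if "transformable lines ?c d" for d
    using even_num_lit_transformable[OF finite_points _ that] line_subset card_line assms one
    by simp
  then have "irreducible_config points lines ?c"
    unfolding reducible_def one by (metis even_zero less_one)
  with one show "1 \<in> {num_lit points c | c. irreducible_config points lines c}"
    by (metis (mono_tags, lifting) mem_Collect_eq)
qed

end

theorem theorem3:
  fixes P :: "'a set" and L :: "'a set set" and p :: nat
  assumes "finite_projective_plane P L p" and "odd p"
  shows "(\<forall>c. even (num_lit P c) \<longrightarrow> (\<exists>d. transformable L c d \<and> num_lit P d = 0))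
    \<and> (\<forall>c. odd (num_lit P c) \<longrightarrow> (\<exists>d. transformable L c d \<and> num_lit P d = 1))
    \<and> worst_case P L = 1"
proof -
  interpret finite_projective_plane P L p by (rule assms(1))
  show ?thesis
    using transformable_mod_2[OF \<open>odd p\<close>] worst_case_eq_1[OF \<open>odd p\<close>]
    by (metis even_iff_mod_2_eq_zero odd_iff_mod_2_eq_one)
qed

end
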